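(* Let $\mu,\nu$ be finite non-negative measures on a measurable space $(\mathcal{X},\mathcal{F})$, with $\nu$ positive (nonzero), and let $f:(0,\infty)\to\mathbb{R}$ be a convex function. Then, given a measurable space $(\mathcal{Y},\mathcal{F}_{\mathcal{Y}})$ and a measurable map $\Gamma:\mathcal{X}\to\mathcal{Y}$, $$D_f(\mu,\nu)\ \ge\ D_f(\mu\Gamma^{-1},\nu\Gamma^{-1}),$$ where $(\mu\Gamma^{-1})(B)=\mu(\Gamma^{-1}(B))$ for all $B\in\mathcal{F}_{\mathcal{Y}}$, and similarly for $\nu$.
   Context: Generalized $f$-divergence: for finite measures $\mu,\nu$ (not necessarily normalized) and convex $f:(0,\infty)\to\mathbb{R}$, $$D_f(\mu,\nu):=\int_{\{\mathrm{d}\nu>0\}}f\left(\frac{\mathrm{d}\mu}{\mathrm{d}\nu}\right)\mathrm{d}\nu+\mu(\{\mathrm{d}\nu=0\})\cdot f'(\infty),$$ where $\mathrm d\mu,\mathrm d\nu$ are Radon–Nikodym densities with respect to a common dominating measure, $f'(\infty):=\lim_{t\to\infty}f(t)/t\in(-\infty,\infty]$, $0\cdot f'(\infty)=0$, and $f(0):=\lim_{t\to0^+}f(t)$. No normalization $f(1)=0$ is required. *)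

theory Defs
  imports "HOL-Analysis.Analysis"
begin

text \<open>When \<open>f\<close> is convex on the open half-line, both limits below exist and are greater than
  \<open>-\<infinity>\<close>; see \<open>ext0_tendsto\<close> and \<open>slope_inf_tendsto\<close>. The values of \<open>f\<close> outside \<open>(0, \<infinity>)\<close> play no role.\<close>

definition ext0 :: "(real \<Rightarrow> real) \<Rightarrow> real \<Rightarrow> ereal" where
  "ext0 f t = (if t = 0 then Lim (at_right 0) (\<lambda>s. ereal (f s)) else ereal (f t))"

definition slope_inf :: "(real \<Rightarrow> real) \<Rightarrow> ereal" where
  "slope_inf f = Lim at_top (\<lambda>t. ereal (f t / t))"

text \<open>The truncation \<open>e2ennreal\<close> sends negative values to \<open>0\<close>, so this is the integral of the
  positive part minus the integral of the negative part. It is meaningful when at most one of the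
  two is infinite; in the divergence below the negative part always has a finite integral, because
  a convex function has an affine minorant and both measures are finite.\<close>

definition ereal_integral :: "'a measure \<Rightarrow> ('a \<Rightarrow> ereal) \<Rightarrow> ereal" where
  "ereal_integral M g =
     enn2ereal (\<integral>\<^sup>+x. e2ennreal (g x) \<partial>M) - enn2ereal (\<integral>\<^sup>+x. e2ennreal (- g x) \<partial>M)"

text \<open>The divergence computed from densities \<open>p\<close> of \<open>\<mu>\<close> and \<open>q\<close> of \<open>\<nu>\<close> with respect to a common
  dominating measure. In \<open>ereal\<close>, \<open>0 * \<infinity> = 0\<close>, which is the convention wanted in both terms.\<close>

definition f_divergence_dens ::
    "(real \<Rightarrow> real) \<Rightarrow> 'a measure \<Rightarrow> 'a measure \<Rightarrow> ('a \<Rightarrow> real) \<Rightarrow> ('a \<Rightarrow> real) \<Rightarrow> ereal" where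
  "f_divergence_dens f \<mu> \<nu> p q =
     ereal_integral \<nu> (\<lambda>x. ext0 f (p x / q x) * indicator {x \<in> space \<nu>. q x > 0} x)
     + enn2ereal (emeasure \<mu> {x \<in> space \<mu>. q x = 0}) * slope_inf f"

definition add_measure :: "'a measure \<Rightarrow> 'a measure \<Rightarrow> 'a measure" where
  "add_measure \<mu> \<nu> = measure_of (space \<mu>) (sets \<mu>) (\<lambda>A. emeasure \<mu> A + emeasure \<nu> A)"

text \<open>The common dominating measure is taken to be \<open>\<mu> + \<nu>\<close>; the lemma
  \<open>f_divergence_eq_dens\<close> below shows that any other choice, and any choice of the densities,
  gives the same value.\<close>

definition f_divergence :: "(real \<Rightarrow> real) \<Rightarrow> 'a measure \<Rightarrow> 'a measure \<Rightarrow> ereal" where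
  "f_divergence f \<mu> \<nu> =
     f_divergence_dens f \<mu> \<nu>
       (\<lambda>x. enn2real (RN_deriv (add_measure \<mu> \<nu>) \<mu> x))
       (\<lambda>x. enn2real (RN_deriv (add_measure \<mu> \<nu>) \<nu> x))"

lemma space_add_measure [simp]: "space (add_measure \<mu> \<nu>) = space \<mu>"
  and sets_add_measure [simp, measurable_cong]: "sets (add_measure \<mu> \<nu>) = sets \<mu>"
  by (simp_all add: add_measure_def)

lemma emeasure_add_measure:
  assumes "sets \<nu> = sets \<mu>" "A \<in> sets \<mu>"
  shows "emeasure (add_measure \<mu> \<nu>) A = emeasure \<mu> A + emeasure \<nu> A"
  unfolding add_measure_def
proof (rule emeasure_measure_of_sigma)
  show "countably_additive (sets \<mu>) (\<lambda>A. emeasure \<mu> A + emeasure \<nu> A)"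
  proof (rule countably_additiveI)
    fix B :: "nat \<Rightarrow> _"
    assume B: "range B \<subseteq> sets \<mu>" "disjoint_family B" "\<Union> (range B) \<in> sets \<mu>"
    have "(\<Sum>i. emeasure \<mu> (B i) + emeasure \<nu> (B i)) = (\<Sum>i. emeasure \<mu> (B i)) + (\<Sum>i. emeasure \<nu> (B i))"
      by (intro suminf_add[symmetric] summableI)
    also have "\<dots> = emeasure \<mu> (\<Union> (range B)) + emeasure \<nu> (\<Union> (range B))"
      using B assms(1) by (simp add: suminf_emeasure)
    finally show "(\<Sum>i. emeasure \<mu> (B i) + emeasure \<nu> (B i)) =
        emeasure \<mu> (\<Union> (range B)) + emeasure \<nu> (\<Union> (range B))" .
  qed
qed (use assms in \<open>auto simp: positive_def sets.sigma_algebra_axioms\<close>)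

lemma f_divergence_eq_dens:
  fixes M :: "'a measure"
  assumes [measurable]: "p \<in> borel_measurable M" "q \<in> borel_measurable M"
    and nonneg: "\<And>x. p x \<ge> 0" "\<And>x. q x \<ge> 0"
    and \<mu>: "\<mu> = density M (\<lambda>x. ennreal (p x))" and \<nu>: "\<nu> = density M (\<lambda>x. ennreal (q x))"
    and fin: "finite_measure \<mu>" "finite_measure \<nu>"
  shows "f_divergence f \<mu> \<nu> = f_divergence_dens f \<mu> \<nu> p q"
proof -
  define L where "L = add_measure \<mu> \<nu>"
  have sets: "sets \<mu> = sets M" "sets \<nu> = sets M" "sets L = sets M" "space L = space M"
    "space \<mu> = space M" "space \<nu> = space M"
    by (simp_all add: \<mu> \<nu> L_def)
  have eL: "emeasure L A = emeasure \<mu> A + emeasure \<nu> A" if "A \<in> sets M" for A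
    unfolding L_def using sets that by (intro emeasure_add_measure) auto
  interpret L: finite_measure L
    using eL[of "space M"] fin[THEN finite_measure.emeasure_finite]
    by (intro finite_measureI) (auto simp: sets)
  have L: "L = density M (\<lambda>x. ennreal (p x) + ennreal (q x))"
  proof (rule measure_eqI)
    fix A assume A: "A \<in> sets L"
    then have [measurable]: "A \<in> sets M" using sets by simp
    show "emeasure L A = emeasure (density M (\<lambda>x. ennreal (p x) + ennreal (q x))) A"
      by (simp add: eL \<mu> \<nu> emeasure_density nn_integral_add[symmetric] distrib_right)
  qed (simp add: sets)
  have RN: "(AE x in M. (ennreal (p x) + ennreal (q x)) * ennreal (enn2real (RN_deriv L N x)) = ennreal (g x))"
    if N: "N = density M (\<lambda>x. ennreal (g x))" "finite_measure N" "g \<in> borel_measurable M"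
      and le: "\<And>A. A \<in> sets M \<Longrightarrow> emeasure N A \<le> emeasure L A" for N g
  proof -
    have [measurable]: "g \<in> borel_measurable M" by fact
    have [measurable]: "RN_deriv L N \<in> borel_measurable M"
      using borel_measurable_RN_deriv[of L N] measurable_cong_sets[OF sets(3) refl] by blast
    have sN: "sets N = sets L" by (simp add: N sets)
    have ac: "absolutely_continuous L N"
      unfolding absolutely_continuous_def null_sets_def using sN sets by (auto dest: le)
    have "AE x in L. RN_deriv L N x \<noteq> \<infinity>"
      by (rule L.RN_deriv_finite) (use N ac sN in \<open>auto intro: finite_measure.axioms(1)\<close>)
    then have fin': "AE x in M. ennreal (p x) + ennreal (q x) > 0 \<longrightarrow> RN_deriv L N x \<noteq> \<infinity>"
      unfolding L by (subst (asm) AE_density) auto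
    have dd: "density L h = density M (\<lambda>x. (ennreal (p x) + ennreal (q x)) * h x)"
      if "h \<in> borel_measurable M" for h
      unfolding L using that by (subst density_density_eq) auto
    have "density M (\<lambda>x. (ennreal (p x) + ennreal (q x)) * RN_deriv L N x) = density L (RN_deriv L N)"
      using dd[of "RN_deriv L N"] by simp
    also have "\<dots> = density M (\<lambda>x. ennreal (g x))"
      using L.density_RN_deriv[OF ac sN] N by simp
    finally have eq: "density M (\<lambda>x. ennreal (g x)) = density M (\<lambda>x. (ennreal (p x) + ennreal (q x)) * RN_deriv L N x)"
      by simp
    have "emeasure N (space M) \<noteq> \<infinity>" using finite_measure.emeasure_finite[OF N(2), of "space M"] by simp
    then have "(\<integral>\<^sup>+x. ennreal (g x) \<partial>M) \<noteq> \<infinity>"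
      by (simp add: N emeasure_density cong: nn_integral_cong)
    then have "AE x in M. ennreal (g x) = (ennreal (p x) + ennreal (q x)) * RN_deriv L N x"
      using eq by (subst (asm) finite_density_unique) auto
    then show ?thesis
      using fin'
    proof eventually_elim
      case (elim x)
      then show ?case
        by (cases "ennreal (p x) + ennreal (q x) = 0") (auto simp: less_top zero_less_iff_neq_zero)
    qed
  qed
  define r s where "r x = enn2real (RN_deriv L \<mu> x)" and "s x = enn2real (RN_deriv L \<nu> x)" for x
  have [measurable]: "r \<in> borel_measurable M" "s \<in> borel_measurable M"
    using borel_measurable_RN_deriv[of L \<mu>] borel_measurable_RN_deriv[of L \<nu>]
      measurable_cong_sets[OF sets(3) refl, of "borel :: ennreal measure"]
    unfolding r_def s_def by auto
  have rs: "r x \<ge> 0" "s x \<ge> 0" for x by (auto simp: r_def s_def)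
  have "AE x in M. (ennreal (p x) + ennreal (q x)) * ennreal (r x) = ennreal (p x)"
    unfolding r_def by (rule RN) (use \<mu> fin eL in auto)
  moreover have "AE x in M. (ennreal (p x) + ennreal (q x)) * ennreal (s x) = ennreal (q x)"
    unfolding s_def by (rule RN) (use \<nu> fin eL in auto)
  ultimately have key: "AE x in M. (p x + q x) * r x = p x \<and> (p x + q x) * s x = q x"
    by eventually_elim
      (simp add: nonneg rs ennreal_plus[symmetric] ennreal_mult[symmetric] del: ennreal_plus)
  have pq: "r x / s x = p x / q x" "s x > 0 \<longleftrightarrow> q x > 0"
    if "(p x + q x) * r x = p x" "(p x + q x) * s x = q x" "q x > 0" for x
  proof -
    have pos: "p x + q x > 0" using nonneg[of x] that(3) by simp
    have "p x / q x = ((p x + q x) * r x) / ((p x + q x) * s x)" using that(1,2) by simp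
    then show "r x / s x = p x / q x" using pos by simp
    show "s x > 0 \<longleftrightarrow> q x > 0" using that(2) pos by (metis zero_less_mult_pos mult_pos_pos)
  qed
  have ratio: "AE x in \<nu>. r x / s x = p x / q x \<and> (s x > 0 \<longleftrightarrow> q x > 0)"
  proof -
    have "AE x in M. 0 < ennreal (q x) \<longrightarrow> r x / s x = p x / q x \<and> (s x > 0 \<longleftrightarrow> q x > 0)"
      using key by eventually_elim (use pq in auto)
    then show ?thesis unfolding \<nu> by (rule AE_density[THEN iffD2, rotated]) simp
  qed
  have null: "AE x in \<mu>. s x = 0 \<longleftrightarrow> q x = 0"
  proof -
    have "AE x in M. 0 < ennreal (p x) \<longrightarrow> (s x = 0 \<longleftrightarrow> q x = 0)"
      using key
    proof eventually_elim
      case (elim x)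
      have "p x + q x \<noteq> 0" if "p x > 0" using that nonneg[of x] by simp
      with elim show ?case by (metis ennreal_less_zero_iff mult_eq_0_iff)
    qed
    then show ?thesis unfolding \<mu> by (rule AE_density[THEN iffD2, rotated]) simp
  qed
  have *: "ereal_integral \<nu> (\<lambda>x. ext0 f (r x / s x) * indicator {x \<in> space \<nu>. s x > 0} x) =
      ereal_integral \<nu> (\<lambda>x. ext0 f (p x / q x) * indicator {x \<in> space \<nu>. q x > 0} x)"
    (is "ereal_integral \<nu> ?F = ereal_integral \<nu> ?G")
  proof -
    have "AE x in \<nu>. ?F x = ?G x"
      using ratio by eventually_elim (simp add: indicator_def)
    then show ?thesis
      unfolding ereal_integral_def
      by (intro arg_cong2[where f="(-)"] arg_cong[where f=enn2ereal] nn_integral_cong_AE)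
         (auto elim!: eventually_mono)
  qed
  have **: "emeasure \<mu> {x \<in> space \<mu>. s x = 0} = emeasure \<mu> {x \<in> space \<mu>. q x = 0}"
    using null by (intro emeasure_eq_AE) (auto simp: sets elim!: eventually_mono)
  show ?thesis
    unfolding f_divergence_def L_def[symmetric] r_def[symmetric] s_def[symmetric]
      f_divergence_dens_def * ** ..
qed

lemma convex_slope_mono:
  fixes f :: "real \<Rightarrow> real"
  assumes f: "convex_on {0<..} f" and "0 < s" "s < t" "s \<noteq> 1" "t \<noteq> 1"
  shows "(f s - f 1) / (s - 1) \<le> (f t - f 1) / (t - 1)"
proof -
  consider "t < 1" | "s < 1" "1 < t" | "1 < s" using assms by linarith
  then show ?thesis
  proof cases
    case 1
    have "(f s - f 1) / (s - 1) \<le> (f t - f 1) / (t - 1)"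
      by (rule convex_on_slope_le(2)[OF f]) (use assms 1 in auto)
    then show ?thesis .
  next
    case 2
    have a: "(f s - f 1) / (s - 1) \<le> (f s - f t) / (s - t)"
      by (rule convex_on_slope_le(1)[OF f]) (use assms 2 in auto)
    have b: "(f s - f t) / (s - t) \<le> (f 1 - f t) / (1 - t)"
      by (rule convex_on_slope_le(2)[OF f]) (use assms 2 in auto)
    have "(f 1 - f t) / (1 - t) = (f t - f 1) / (t - 1)"
      using 2 by (simp add: field_simps)
    then show ?thesis using a b by linarith
  next
    case 3
    have "(f 1 - f s) / (1 - s) \<le> (f 1 - f t) / (1 - t)"
      by (rule convex_on_slope_le(1)[OF f]) (use assms 3 in auto)
    then show ?thesis
      by (metis minus_diff_eq minus_divide_divide)
  qed
qed

lemma ext0_tendsto: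
  assumes f: "convex_on {0<..} f"
  shows "((\<lambda>s. ereal (f s)) \<longlongrightarrow> ext0 f 0) (at_right 0)" and "ext0 f 0 > -\<infinity>"
proof -
  define g where "g s = ereal ((f s - f 1) / (s - 1))" for s
  define G where "G = (INF s\<in>{0<..<1}. g s)"
  have g: "(g \<longlongrightarrow> G) (at_right 0)"
  proof (rule order_tendstoI)
    fix a assume "a < G"
    then have "a < g s" if "s \<in> {0<..<1}" for s
      using that unfolding G_def by (meson INF_lower order_less_le_trans)
    then show "\<forall>\<^sub>F s in at_right 0. a < g s"
      by (auto simp: eventually_at_right_field intro!: exI[of _ 1])
  next
    fix a assume "G < a"
    then obtain t where t: "t \<in> {0<..<1}" "g t < a" unfolding G_def by (auto simp: INF_less_iff)
    have "g s < a" if "0 < s" "s < t" for s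
      using convex_slope_mono[OF f that] t that order_le_less_trans[of "g s" "g t" a] by (auto simp: g_def)
    then show "\<forall>\<^sub>F s in at_right 0. g s < a"
      using t by (auto simp: eventually_at_right_field intro!: exI[of _ t])
  qed
  have "G \<le> g (1/2)" unfolding G_def by (rule INF_lower) auto
  then have G: "G \<noteq> \<infinity>" by (auto simp: g_def)
  have "((\<lambda>s. ereal (s - 1)) \<longlongrightarrow> ereal (0 - 1)) (at_right 0)"
    by (intro tendsto_intros)
  then have "((\<lambda>s. ereal (s - 1) * g s) \<longlongrightarrow> ereal (0 - 1) * G) (at_right 0)"
    using g by (intro tendsto_mult_ereal) auto
  then have "((\<lambda>s. ereal (f 1) + ereal (s - 1) * g s) \<longlongrightarrow> ereal (f 1) + ereal (0 - 1) * G) (at_right 0)"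
    by (intro tendsto_add_ereal_general) auto
  moreover have "\<forall>\<^sub>F s in at_right 0. ereal (f 1) + ereal (s - 1) * g s = ereal (f s)"
    by (auto simp: eventually_at_right_field g_def intro!: exI[of _ 1])
  ultimately have L: "((\<lambda>s. ereal (f s)) \<longlongrightarrow> ereal (f 1) + ereal (0 - 1) * G) (at_right 0)"
    by (blast intro: Lim_transform_eventually)
  then have eq: "ext0 f 0 = ereal (f 1) + ereal (0 - 1) * G"
    unfolding ext0_def by (simp add: tendsto_Lim)
  with L show "((\<lambda>s. ereal (f s)) \<longlongrightarrow> ext0 f 0) (at_right 0)" by simp
  show "ext0 f 0 > -\<infinity>" unfolding eq using G by (cases G) auto
qed

lemma slope_inf_tendsto:
  assumes f: "convex_on {0<..} f"
  shows "((\<lambda>t. ereal (f t / t)) \<longlongrightarrow> slope_inf f) at_top" and "slope_inf f > -\<infinity>"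
proof -
  define g where "g s = ereal ((f s - f 1) / (s - 1))" for s
  define G where "G = (SUP s\<in>{1<..}. g s)"
  have g: "(g \<longlongrightarrow> G) at_top"
  proof (rule order_tendstoI)
    fix a assume "G < a"
    then have "g s < a" if "s > 1" for s
      using that unfolding G_def by (meson SUP_upper order_le_less_trans greaterThan_iff)
    then show "\<forall>\<^sub>F s in at_top. g s < a"
      by (auto simp: eventually_at_top_dense)
  next
    fix a assume "a < G"
    then obtain t where t: "t > 1" "a < g t" unfolding G_def by (auto simp: less_SUP_iff)
    have "a < g s" if "t < s" for s
      using convex_slope_mono[OF f _ that] t that order_less_le_trans[of a "g t" "g s"] by (auto simp: g_def)
    then show "\<forall>\<^sub>F s in at_top. a < g s"
      by (auto simp: eventually_at_top_dense)
  qed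
  have "g 2 \<le> G" unfolding G_def by (rule SUP_upper) auto
  then have G: "G \<noteq> -\<infinity>" by (auto simp: g_def)
  have inv: "((\<lambda>t::real. 1 / t) \<longlongrightarrow> 0) at_top"
    using tendsto_inverse_0_at_top[OF filterlim_ident] by (simp add: inverse_eq_divide)
  have "((\<lambda>t. ereal (1 - 1 / t)) \<longlongrightarrow> ereal (1 - 0)) at_top"
    by (intro tendsto_intros inv)
  then have 1: "((\<lambda>t. ereal (1 - 1 / t) * g t) \<longlongrightarrow> ereal (1 - 0) * G) at_top"
    using g by (intro tendsto_mult_ereal) auto
  have "((\<lambda>t. ereal (f 1 * (1 / t))) \<longlongrightarrow> ereal (f 1 * 0)) at_top"
    by (intro tendsto_intros inv)
  from tendsto_add_ereal_general[OF _ this 1]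
  have "((\<lambda>t. ereal (f 1 * (1 / t)) + ereal (1 - 1 / t) * g t) \<longlongrightarrow> G) at_top"
    by (auto simp: one_ereal_def[symmetric] zero_ereal_def[symmetric])
  moreover have "\<forall>\<^sub>F t in at_top. ereal (f 1 * (1 / t)) + ereal (1 - 1 / t) * g t = ereal (f t / t)"
    using eventually_gt_at_top[of 1]
  proof eventually_elim
    case (elim t)
    then have "(1 - 1 / t) * ((f t - f 1) / (t - 1)) = (f t - f 1) / t"
      by (simp add: divide_simps)
    then show ?case
      by (simp add: g_def diff_divide_distrib)
  qed
  ultimately have L: "((\<lambda>t. ereal (f t / t)) \<longlongrightarrow> G) at_top"
    by (blast intro: Lim_transform_eventually)
  then have eq: "slope_inf f = G"
    unfolding slope_inf_def by (simp add: tendsto_Lim)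
  with L show "((\<lambda>t. ereal (f t / t)) \<longlongrightarrow> slope_inf f) at_top" by simp
  show "slope_inf f > -\<infinity>" unfolding eq using G by (cases G) auto
qed

end

theory Submission
  imports Defs
begin

text \<open>A convex \<open>f\<close> is the supremum of countably many affine functions \<open>a t + b\<close>, and \<open>f'(\<infinity>)\<close> is
  the supremum of their slopes. Hence \<open>D\<^sub>f(\<mu>, \<nu>)\<close> is the supremum of \<open>\<integral>\<alpha> d\<mu> + \<integral>\<beta> d\<nu>\<close> over all bounded
  measurable pairs \<open>(\<alpha>, \<beta>)\<close> whose values are affine minorants of \<open>f\<close>. Composing with \<open>\<Gamma>\<close> turns
  a pair on the target into a pair on the source with the same value, so the supremum on the
  source is at least as large.\<close>

section \<open>Affine minorants of a convex function\<close>

text \<open>Minorants are stored as coefficient pairs rather than functions, because the slope will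
  be integrated against \<mu> and the intercept against \<nu>.\<close>

definition affine_minorants :: "(real \<Rightarrow> real) \<Rightarrow> (real \<times> real) set" where
  "affine_minorants f = {(a, b). \<forall>t>0. a * t + b \<le> f t}"

text \<open>The infimum of the difference quotients from \<open>t\<close> to points on its right is
  the right derivative, which is a subgradient of a convex function at an interior point. The
  minorant is the supporting line at \<open>t\<close>.\<close>

lemma convex_tangent_minorant:
  fixes f :: "real \<Rightarrow> real"
  assumes "convex_on {0<..} f" "t > 0"
  obtains a b where "(a, b) \<in> affine_minorants f" "a * t + b = f t"
proof -
  define a where "a = Inf ((\<lambda>s. (f t - f s) / (t - s)) ` ({t<..} \<inter> {0<..}))"
  have "f s \<ge> f t + a * (s - t)" if "s > 0" for s
    unfolding a_def using assms that by (intro convex_le_Inf_differential) (auto simp: interior_open)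
  then have "(a, f t - a * t) \<in> affine_minorants f"
    by (auto simp: affine_minorants_def algebra_simps)
  then show thesis by (rule that) simp
qed

text \<open>Only \<open>t = 0\<close> calls for an argument: there the inequality on positive
  arguments survives the limit from the right.\<close>

lemma affine_minorant_le_ext0:
  assumes "convex_on {0<..} f" "(a, b) \<in> affine_minorants f" "t \<ge> 0"
  shows "ereal (a * t + b) \<le> ext0 f t"
proof (cases "t = 0")
  case True
  have "((\<lambda>s. ereal (a * s + b)) \<longlongrightarrow> ereal (a * 0 + b)) (at_right 0)"
    by (intro tendsto_intros)
  moreover have "\<forall>\<^sub>F s in at_right 0. ereal (a * s + b) \<le> ereal (f s)"
    using assms(2) by (auto simp: affine_minorants_def eventually_at_right_field intro: exI[of _ 1])
  ultimately have "ereal (a * 0 + b) \<le> ext0 f 0"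
    using trivial_limit_at_right_real ext0_tendsto(1)[OF assms(1)] tendsto_le by blast
  then show ?thesis using True by simp
next
  case False
  then show ?thesis using assms by (auto simp: ext0_def affine_minorants_def)
qed

text \<open>Dividing the inequality by \<open>t\<close> and letting \<open>t\<close> tend to
  \<infinity> makes the intercept vanish.\<close>

lemma affine_minorant_slope_le:
  assumes "convex_on {0<..} f" "(a, b) \<in> affine_minorants f"
  shows "ereal a \<le> slope_inf f"
proof -
  have "((\<lambda>t::real. inverse t) \<longlongrightarrow> 0) at_top"
    by (rule tendsto_inverse_0_at_top[OF filterlim_ident])
  then have "((\<lambda>t. ereal (a + b * inverse t)) \<longlongrightarrow> ereal (a + b * 0)) at_top"
    by (intro tendsto_intros)
  moreover have "\<forall>\<^sub>F t in at_top. ereal (a + b * inverse t) \<le> ereal (f t / t)"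
    using eventually_gt_at_top[of 0]
  proof eventually_elim
    case (elim t)
    then have "a * t + b \<le> f t" using assms(2) by (auto simp: affine_minorants_def)
    then have "(a * t + b) / t \<le> f t / t" using elim by (intro divide_right_mono) auto
    then show ?case using elim by (simp add: add_divide_distrib inverse_eq_divide)
  qed
  ultimately have "ereal (a + b * 0) \<le> slope_inf f"
    using trivial_limit_at_top_linorder slope_inf_tendsto(1)[OF assms(1)] tendsto_le by blast
  then show ?thesis by simp
qed

text \<open>For \<open>t > 0\<close> the supporting line is exact. At the boundary point 0 there may
  be none, as \<open>f\<close> can blow up or have slope -\<infinity> there, so a steep line
  starting slightly below \<open>ext0 f 0\<close> is used instead.\<close>

lemma affine_minorant_approx_ext0:
  assumes f: "convex_on {0<..} f" and t: "t \<ge> 0" and c: "ereal c < ext0 f t"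
  shows "\<exists>(a, b)\<in>affine_minorants f. c < a * t + b"
proof (cases "t = 0")
  case False
  with t obtain a b where "(a, b) \<in> affine_minorants f" "a * t + b = f t"
    using convex_tangent_minorant[OF f, of t] by auto
  with c False show ?thesis by (auto simp: ext0_def intro!: bexI[of _ "(a, b)"])
next
  case True
  obtain d where d: "ereal c < ereal d" "ereal d < ext0 f t"
    using ereal_dense2[OF c] by auto
  obtain a1 b1 where m: "(a1, b1) \<in> affine_minorants f"
    using convex_tangent_minorant[OF f zero_less_one] by blast
  have "\<forall>\<^sub>F s in at_right 0. ereal d < ereal (f s)"
    using ext0_tendsto(1)[OF f] d True by (intro order_tendstoD(1)) auto
  then obtain \<delta> where \<delta>: "\<delta> > 0" "\<And>s. 0 < s \<Longrightarrow> s < \<delta> \<Longrightarrow> d < f s"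
    by (auto simp: eventually_at_right_field)
  \<comment> \<open>A slope at most 0 keeps the line below \<open>d\<close>, hence below
    \<open>f\<close>, up to \<delta>. The second bound puts the line under the known minorant
    \<open>a1 * s + b1\<close> from \<delta> onwards, where \<open>s / \<delta>\<close> is at least
    1.\<close>
  define a where "a = min 0 (a1 - \<bar>b1 - d\<bar> / \<delta>)"
  have "a * s + d \<le> f s" if s: "s > 0" for s
  proof (cases "s < \<delta>")
    case True
    have "a * s \<le> 0" using s by (simp add: a_def mult_nonpos_nonneg)
    then show ?thesis using \<delta>(2)[OF s True] by linarith
  next
    case False
    have "a * s \<le> (a1 - \<bar>b1 - d\<bar> / \<delta>) * s"
      using s by (intro mult_right_mono) (auto simp: a_def)
    moreover have "\<bar>b1 - d\<bar> * 1 \<le> \<bar>b1 - d\<bar> * (s / \<delta>)"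
      using False \<delta>(1) by (intro mult_left_mono) auto
    moreover have "a1 * s + b1 \<le> f s" using m s by (auto simp: affine_minorants_def)
    ultimately show ?thesis by (simp add: algebra_simps)
  qed
  then have "(a, d) \<in> affine_minorants f" by (auto simp: affine_minorants_def)
  then show ?thesis using True d by auto
qed

text \<open>The counterpart at \<infinity>: a slope \<open>d\<close> slightly below
  \<open>slope_inf f\<close> is fixed, and the intercept is lowered until the line lies under
  \<open>f\<close>.\<close>

lemma affine_minorant_approx_slope:
  assumes f: "convex_on {0<..} f" and c: "ereal c < slope_inf f"
  shows "\<exists>(a, b)\<in>affine_minorants f. c < a"
proof -
  obtain d where d: "ereal c < ereal d" "ereal d < slope_inf f"
    using ereal_dense2[OF c] by auto
  obtain a1 b1 where m: "(a1, b1) \<in> affine_minorants f"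
    using convex_tangent_minorant[OF f zero_less_one] by blast
  have "\<forall>\<^sub>F s in at_top. ereal d < ereal (f s / s)"
    using slope_inf_tendsto(1)[OF f] d by (intro order_tendstoD(1)) auto
  then obtain N where N: "\<And>s. s > N \<Longrightarrow> d < f s / s"
    by (auto simp: eventually_at_top_dense)
  \<comment> \<open>Beyond \<open>N\<close> already \<open>d * s \<le> f s\<close>, so an intercept
    at most 0 suffices. Up to \<open>N\<close>, changing the slope from \<open>a1\<close> to
    \<open>d\<close> raises the line by at most the product subtracted from
    \<open>b1\<close>.\<close>
  define b where "b = min 0 (b1 - \<bar>a1 - d\<bar> * \<bar>N\<bar>)"
  have "d * s + b \<le> f s" if s: "s > 0" for s
  proof (cases "s > N")
    case True
    then have "d * s \<le> f s" using N[OF True] s by (simp add: field_simps)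
    then show ?thesis by (simp add: b_def)
  next
    case False
    have "(d - a1) * s \<le> \<bar>a1 - d\<bar> * \<bar>N\<bar>"
      using False s by (intro mult_mono) auto
    moreover have "a1 * s + b1 \<le> f s" using m s by (auto simp: affine_minorants_def)
    moreover have "b \<le> b1 - \<bar>a1 - d\<bar> * \<bar>N\<bar>" by (simp add: b_def)
    ultimately show ?thesis by (simp add: algebra_simps)
  qed
  then have "(d, b) \<in> affine_minorants f" by (auto simp: affine_minorants_def)
  then show ?thesis using d by auto
qed

text \<open>Lowering both coefficients keeps an affine minorant on the positive half-line below \<open>f\<close>.\<close>

lemma affine_minorant_rational:
  assumes "(a, b) \<in> affine_minorants f" "\<epsilon> > 0"
  shows "\<exists>(a', b')\<in>affine_minorants f \<inter> \<rat> \<times> \<rat>. a - \<epsilon> < a' \<and> b - \<epsilon> < b'"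
proof -
  obtain a' b' where *: "a' \<in> \<rat>" "a - \<epsilon> < a'" "a' < a" "b' \<in> \<rat>" "b - \<epsilon> < b'" "b' < b"
    using Rats_dense_in_real[of "a - \<epsilon>" a] Rats_dense_in_real[of "b - \<epsilon>" b] assms(2) by auto
  have "a' * t + b' \<le> f t" if "t > 0" for t
  proof -
    have "a' * t \<le> a * t" using * that by simp
    moreover have "a * t + b \<le> f t" using assms(1) that by (auto simp: affine_minorants_def)
    ultimately show ?thesis using * by linarith
  qed
  then show ?thesis using * by (auto simp: affine_minorants_def)
qed

text \<open>Rational coefficients make the family countable, so that near-optimal minorants can
  later be selected measurably. Nothing is lost, since coefficients can be lowered to rationals by
  arbitrarily little.\<close>

lemma ext0_eq_SUP:
  assumes f: "convex_on {0<..} f" and t: "t \<ge> 0"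
  shows "(SUP (a, b)\<in>affine_minorants f \<inter> \<rat> \<times> \<rat>. ereal (a * t + b)) = ext0 f t"
proof (rule antisym)
  show "(SUP (a, b)\<in>affine_minorants f \<inter> \<rat> \<times> \<rat>. ereal (a * t + b)) \<le> ext0 f t"
    using affine_minorant_le_ext0[OF f _ t] by (auto intro!: SUP_least)
next
  show "ext0 f t \<le> (SUP (a, b)\<in>affine_minorants f \<inter> \<rat> \<times> \<rat>. ereal (a * t + b))"
  proof (rule dense_le)
    fix y assume "y < ext0 f t"
    then obtain c where c: "y < ereal c" "ereal c < ext0 f t" using ereal_dense2 by blast
    obtain a b where ab: "(a, b) \<in> affine_minorants f" "c < a * t + b"
      using affine_minorant_approx_ext0[OF f t c(2)] by auto
    \<comment> \<open>Lowering both coefficients by \<epsilon> costs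
      \<open>\<epsilon> * (t + 1)\<close> at the point \<open>t\<close>, which is exactly the
      available slack.\<close>
    define \<epsilon> where "\<epsilon> = (a * t + b - c) / (t + 1)"
    have "\<epsilon> * (t + 1) = a * t + b - c" using t by (simp add: \<epsilon>_def)
    then have \<epsilon>: "\<epsilon> > 0" "\<epsilon> * t + \<epsilon> = a * t + b - c"
      using ab t by (auto simp: \<epsilon>_def distrib_left)
    obtain a' b' where ab': "(a', b') \<in> affine_minorants f \<inter> \<rat> \<times> \<rat>" "a - \<epsilon> < a'" "b - \<epsilon> < b'"
      using affine_minorant_rational[OF ab(1) \<epsilon>(1)] by auto
    have "(a - \<epsilon>) * t \<le> a' * t" using ab' t by (intro mult_right_mono) auto
    then have "c \<le> a' * t + b'" using ab' \<epsilon>(2) by (simp add: algebra_simps)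
    then have "y \<le> ereal (a' * t + b')" using c(1) by (meson ereal_less_eq(3) less_le_trans order.strict_implies_order)
    also have "\<dots> \<le> (SUP (a, b)\<in>affine_minorants f \<inter> \<rat> \<times> \<rat>. ereal (a * t + b))"
      using ab' by (intro SUP_upper2[of "(a', b')"]) auto
    finally show "y \<le> (SUP (a, b)\<in>affine_minorants f \<inter> \<rat> \<times> \<rat>. ereal (a * t + b))" .
  qed
qed

text \<open>The same countable family also recovers the weight of the singular part, so one
  enumeration serves both terms of the divergence.\<close>

lemma slope_inf_eq_SUP:
  assumes f: "convex_on {0<..} f"
  shows "(SUP (a, b)\<in>affine_minorants f \<inter> \<rat> \<times> \<rat>. ereal a) = slope_inf f"
proof (rule antisym)
  show "(SUP (a, b)\<in>affine_minorants f \<inter> \<rat> \<times> \<rat>. ereal a) \<le> slope_inf f"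
    using affine_minorant_slope_le[OF f] by (auto intro!: SUP_least)
next
  show "slope_inf f \<le> (SUP (a, b)\<in>affine_minorants f \<inter> \<rat> \<times> \<rat>. ereal a)"
  proof (rule dense_le)
    fix y assume "y < slope_inf f"
    then obtain c where c: "y < ereal c" "ereal c < slope_inf f" using ereal_dense2 by blast
    obtain a b where ab: "(a, b) \<in> affine_minorants f" "c < a"
      using affine_minorant_approx_slope[OF f c(2)] by auto
    obtain a' b' where ab': "(a', b') \<in> affine_minorants f \<inter> \<rat> \<times> \<rat>" "a - (a - c) < a'"
      using affine_minorant_rational[OF ab(1), of "a - c"] ab(2) by auto
    then have "y \<le> ereal a'" using c(1) by (cases y) auto
    also have "\<dots> \<le> (SUP (a, b)\<in>affine_minorants f \<inter> \<rat> \<times> \<rat>. ereal a)"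
      using ab' by (intro SUP_upper2[of "(a', b')"]) auto
    finally show "y \<le> (SUP (a, b)\<in>affine_minorants f \<inter> \<rat> \<times> \<rat>. ereal a)" .
  qed
qed

section \<open>Measurable selection of running maxima\<close>

text \<open>The winning candidate is kept rather than its score, so that slope and intercept can be
  read off it separately.\<close>

primrec running_argmax :: "(nat \<Rightarrow> 'c) \<Rightarrow> ('c \<Rightarrow> real) \<Rightarrow> nat \<Rightarrow> 'c" where
  "running_argmax c v 0 = c 0"
| "running_argmax c v (Suc n) =
    (if v (running_argmax c v n) < v (c (Suc n)) then c (Suc n) else running_argmax c v n)"

lemma running_argmax_in: "running_argmax c v n \<in> c ` {..n}"
  by (induction n) auto

lemma incseq_running_argmax: "incseq (\<lambda>n. v (running_argmax c v n))"
  by (rule incseq_SucI) simp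

lemma running_argmax_ge: "v (c n) \<le> v (running_argmax c v n)"
  by (cases n) auto

text \<open>Every running maximum is itself one of the scores, and every score is dominated by the
  running maximum at its own index.\<close>

lemma SUP_running_argmax:
  "(SUP n. ereal (v (running_argmax c v n))) = (SUP x\<in>range c. ereal (v x))"
proof (rule antisym)
  show "(SUP n. ereal (v (running_argmax c v n))) \<le> (SUP x\<in>range c. ereal (v x))"
    using running_argmax_in[of c v] by (intro SUP_least SUP_upper) auto
  show "(SUP x\<in>range c. ereal (v x)) \<le> (SUP n. ereal (v (running_argmax c v n)))"
    unfolding image_image by (intro SUP_mono) (use running_argmax_ge[of v c] in auto)
qed

text \<open>Each stage is a case distinction on a measurable comparison. The induction generalizes
  over \<open>u\<close>, since its step uses the hypothesis for \<open>v\<close>, inside the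
  comparison, as well as for the given \<open>u\<close>.\<close>

lemma measurable_running_argmax:
  fixes u :: "'a \<Rightarrow> 'c \<Rightarrow> real"
  assumes v: "\<And>k. (\<lambda>x. v x k) \<in> borel_measurable M" and u: "\<And>k. (\<lambda>x. u x k) \<in> borel_measurable M"
  shows "(\<lambda>x. u x (running_argmax c (v x) n)) \<in> borel_measurable M"
  using u
proof (induction n arbitrary: u)
  case (Suc n)
  note [measurable] = v Suc.prems Suc.IH[OF v] Suc.IH[OF Suc.prems]
  have "(\<lambda>x. if v x (running_argmax c (v x) n) < v x (c (Suc n)) then u x (c (Suc n))
      else u x (running_argmax c (v x) n)) \<in> borel_measurable M"
    by measurable
  then show ?case by (simp add: if_distrib)
qed simp

section \<open>Integrals of extended real functions\<close>

lemma ereal_integral_ereal: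
  assumes "integrable M g"
  shows "ereal_integral M (\<lambda>x. ereal (g x)) = ereal (\<integral>x. g x \<partial>M)"
proof -
  obtain r s where rs: "r \<ge> 0" "s \<ge> 0" "(\<integral>\<^sup>+x. ennreal (g x) \<partial>M) = ennreal r"
      "(\<integral>\<^sup>+x. ennreal (- g x) \<partial>M) = ennreal s" "integral\<^sup>L M g = r - s"
    by (rule integrableE[OF assms])
  then show ?thesis by (simp add: ereal_integral_def enn2ereal_ennreal)
qed

lemma ereal_integral_mono:
  assumes "\<And>x. x \<in> space M \<Longrightarrow> g x \<le> h x"
  shows "ereal_integral M g \<le> ereal_integral M h"
  unfolding ereal_integral_def using assms
  by (intro ereal_minus_mono)
     (auto intro!: nn_integral_mono e2ennreal_mono simp: less_eq_ennreal.rep_eq[symmetric])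

text \<open>The positive parts increase, so monotone convergence applies. The negative parts
  decrease and are dominated by the integrable negative part of \<open>g 0\<close>, so dominated
  convergence applies.\<close>

lemma ereal_integral_monotone_convergence:
  assumes g: "\<And>n. integrable M (g n)" and mono: "\<And>x. incseq (\<lambda>n. g n x)"
    and h: "\<And>x. h x = (SUP n. ereal (g n x))"
  shows "(\<lambda>n. ereal (\<integral>x. g n x \<partial>M)) \<longlonglongrightarrow> ereal_integral M h"
proof -
  have [measurable]: "g n \<in> borel_measurable M" for n using g by auto
  have [measurable]: "h \<in> borel_measurable M" unfolding h[abs_def] by measurable
  have lim: "(\<lambda>n. ereal (g n x)) \<longlonglongrightarrow> h x" for x
    unfolding h using mono[of x] by (intro LIMSEQ_SUP) (auto simp: incseq_def)
  have g0: "(\<integral>\<^sup>+x. e2ennreal (- ereal (g 0 x)) \<partial>M) < \<infinity>"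
    using g[of 0] by (auto simp: real_integrable_def less_top)
  have pos: "(\<lambda>n. \<integral>\<^sup>+x. e2ennreal (ereal (g n x)) \<partial>M) \<longlonglongrightarrow> (\<integral>\<^sup>+x. e2ennreal (h x) \<partial>M)"
    using mono by (intro nn_integral_LIMSEQ tendsto_e2ennrealI lim)
      (auto simp: incseq_def le_fun_def intro!: ennreal_leI)
  have neg_le: "e2ennreal (- ereal (g n x)) \<le> e2ennreal (- ereal (g 0 x))" for n x
    using mono[of x] by (intro e2ennreal_mono) (auto simp: incseq_def)
  have neg: "(\<lambda>n. \<integral>\<^sup>+x. e2ennreal (- ereal (g n x)) \<partial>M) \<longlonglongrightarrow> (\<integral>\<^sup>+x. e2ennreal (- h x) \<partial>M)"
  proof (rule nn_integral_dominated_convergence[where w = "\<lambda>x. e2ennreal (- ereal (g 0 x))"])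
    show "AE x in M. (\<lambda>n. e2ennreal (- ereal (g n x))) \<longlonglongrightarrow> e2ennreal (- h x)"
      by (intro AE_I2 tendsto_e2ennrealI tendsto_uminus_ereal lim)
  qed (use g0 neg_le in auto)
  \<comment> \<open>The limit of the negative parts has a finite integral, which excludes
    \<infinity> - \<infinity> when the two limits are subtracted.\<close>
  have "- h x \<le> - ereal (g 0 x)" for x unfolding h ereal_minus_le_minus by (rule SUP_upper) simp
  then have "(\<integral>\<^sup>+x. e2ennreal (- h x) \<partial>M) \<le> (\<integral>\<^sup>+x. e2ennreal (- ereal (g 0 x)) \<partial>M)"
    by (intro nn_integral_mono e2ennreal_mono) simp
  then have "(\<integral>\<^sup>+x. e2ennreal (- h x) \<partial>M) \<noteq> \<infinity>" using g0 by (auto simp: top_unique)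
  then have fin: "enn2ereal (\<integral>\<^sup>+x. e2ennreal (- h x) \<partial>M) \<noteq> \<infinity>"
    by (simp only: enn2ereal_eq_top_iff infinity_ennreal_def not_False_eq_True)
  have "(\<lambda>n. ereal_integral M (\<lambda>x. ereal (g n x))) \<longlonglongrightarrow> ereal_integral M h"
    unfolding ereal_integral_def
    by (intro tendsto_diff_ereal_general tendsto_enn2erealI pos neg) (use fin in auto)
  then show ?thesis by (simp add: ereal_integral_ereal g)
qed

section \<open>Variational representation of the divergence\<close>

text \<open>The admissible pairs of the variational formula. Boundedness gives integrability against
  every finite measure, and the absence of densities makes the notion stable under composition with
  a measurable map.\<close>

definition minorant_fields :: "(real \<Rightarrow> real) \<Rightarrow> 'a measure \<Rightarrow> ('a \<Rightarrow> real) \<Rightarrow> ('a \<Rightarrow> real) \<Rightarrow> bool" where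
  "minorant_fields f M \<alpha> \<beta> \<longleftrightarrow>
     \<alpha> \<in> borel_measurable M \<and> \<beta> \<in> borel_measurable M \<and>
     (\<exists>K. \<forall>x\<in>space M. \<bar>\<alpha> x\<bar> \<le> K \<and> \<bar>\<beta> x\<bar> \<le> K) \<and>
     (\<forall>x\<in>space M. (\<alpha> x, \<beta> x) \<in> affine_minorants f)"

section \<open>The two halves of the variational formula for fixed densities\<close>

context
  fixes M :: "'a measure" and p q :: "'a \<Rightarrow> real" and \<mu> \<nu> :: "'a measure"
  assumes p: "p \<in> borel_measurable M" and q: "q \<in> borel_measurable M"
    and nonneg: "\<And>x. p x \<ge> 0" "\<And>x. q x \<ge> 0"
    and \<mu>: "\<mu> = density M (\<lambda>x. ennreal (p x))" and \<nu>: "\<nu> = density M (\<lambda>x. ennreal (q x))"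
    and fin: "finite_measure \<mu>" "finite_measure \<nu>"
begin

text \<open>A bounded function is integrable against the finite measures \<mu> and \<nu>; this is
  then rewritten over \<open>M\<close>, which may itself be infinite.\<close>

lemma bounded_integrable_densities:
  fixes \<alpha> :: "'a \<Rightarrow> real"
  assumes \<alpha>: "\<alpha> \<in> borel_measurable M" and K: "\<And>x. x \<in> space M \<Longrightarrow> \<bar>\<alpha> x\<bar> \<le> K"
  shows "integrable M (\<lambda>x. p x * \<alpha> x)" "integrable M (\<lambda>x. q x * \<alpha> x)"
proof -
  note [measurable] = p q \<alpha>
  have "integrable \<mu> \<alpha>" "integrable \<nu> \<alpha>"
    by (rule finite_measure.integrable_const_bound[where B = K];
        use fin K in \<open>auto simp: \<mu> \<nu>\<close>)+
  then show "integrable M (\<lambda>x. p x * \<alpha> x)" "integrable M (\<lambda>x. q x * \<alpha> x)"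
    by (simp_all add: \<mu> \<nu> integrable_density nonneg)
qed

text \<open>Over \<open>M\<close> the integrand is
  \<open>p x * \<alpha> x + q x * \<beta> x\<close>. Where \<open>q x > 0\<close> the factor
  \<open>q x\<close> can be pulled out, and where \<open>q x = 0\<close> only the first summand
  survives. The two pieces match the two terms of the divergence.\<close>

lemma integral_split_densities:
  fixes \<alpha> \<beta> :: "'a \<Rightarrow> real"
  assumes \<alpha>: "\<alpha> \<in> borel_measurable M" and \<beta>: "\<beta> \<in> borel_measurable M"
    and K: "\<And>x. x \<in> space M \<Longrightarrow> \<bar>\<alpha> x\<bar> \<le> K" "\<And>x. x \<in> space M \<Longrightarrow> \<bar>\<beta> x\<bar> \<le> K"
  shows "integrable \<nu> (\<lambda>x. (\<alpha> x * (p x / q x) + \<beta> x) * indicator {x \<in> space \<nu>. q x > 0} x)" (is ?I)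
    and "integrable \<mu> (\<lambda>x. \<alpha> x * indicator {x \<in> space \<mu>. q x = 0} x)" (is ?J)
    and "(\<integral>x. \<alpha> x \<partial>\<mu>) + (\<integral>x. \<beta> x \<partial>\<nu>) =
      (\<integral>x. (\<alpha> x * (p x / q x) + \<beta> x) * indicator {x \<in> space \<nu>. q x > 0} x \<partial>\<nu>) +
      (\<integral>x. \<alpha> x * indicator {x \<in> space \<mu>. q x = 0} x \<partial>\<mu>)" (is ?E)
proof -
  note [measurable] = p q \<alpha> \<beta>
  have sp: "space \<mu> = space M" "space \<nu> = space M" by (simp_all add: \<mu> \<nu>)
  let ?P = "indicator {x \<in> space M. q x > 0} :: 'a \<Rightarrow> real"
  let ?Z = "indicator {x \<in> space M. q x = 0} :: 'a \<Rightarrow> real"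
  have i: "integrable M (\<lambda>x. p x * \<alpha> x)" "integrable M (\<lambda>x. q x * \<beta> x)"
    using bounded_integrable_densities \<alpha> \<beta> K by blast+
  have "integrable M (\<lambda>x. ?P x *\<^sub>R (p x * \<alpha> x))" "integrable M (\<lambda>x. ?P x *\<^sub>R (q x * \<beta> x))"
    and j: "integrable M (\<lambda>x. ?Z x *\<^sub>R (p x * \<alpha> x))"
    by (intro integrable_mult_indicator i; measurable)+
  then have "integrable M (\<lambda>x. ?P x *\<^sub>R (p x * \<alpha> x) + ?P x *\<^sub>R (q x * \<beta> x))" by simp
  also have "?this \<longleftrightarrow> integrable M (\<lambda>x. q x * ((\<alpha> x * (p x / q x) + \<beta> x) * ?P x))"
    by (intro Bochner_Integration.integrable_cong) (auto simp: indicator_def field_simps)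
  finally have k: "integrable M (\<lambda>x. q x * ((\<alpha> x * (p x / q x) + \<beta> x) * ?P x))" .
  then show ?I by (simp add: \<nu> integrable_density nonneg)
  have j': "integrable M (\<lambda>x. p x * (\<alpha> x * ?Z x))" using j by (simp add: mult_ac)
  then show ?J by (simp add: \<mu> integrable_density nonneg)
  have "(\<integral>x. \<alpha> x \<partial>\<mu>) + (\<integral>x. \<beta> x \<partial>\<nu>) = (\<integral>x. p x * \<alpha> x + q x * \<beta> x \<partial>M)"
    using i by (simp add: \<mu> \<nu> integral_density nonneg)
  also have "\<dots> = (\<integral>x. q x * ((\<alpha> x * (p x / q x) + \<beta> x) * ?P x) + p x * (\<alpha> x * ?Z x) \<partial>M)"
  proof (rule Bochner_Integration.integral_cong[OF refl])
    fix x assume "x \<in> space M"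
    then show "p x * \<alpha> x + q x * \<beta> x = q x * ((\<alpha> x * (p x / q x) + \<beta> x) * ?P x) + p x * (\<alpha> x * ?Z x)"
      using nonneg(2)[of x] by (cases "q x = 0") (auto simp: indicator_def field_simps)
  qed
  also have "\<dots> = (\<integral>x. q x * ((\<alpha> x * (p x / q x) + \<beta> x) * ?P x) \<partial>M) + (\<integral>x. p x * (\<alpha> x * ?Z x) \<partial>M)"
    using k j' by simp
  finally show ?E
    by (simp add: sp, simp add: \<mu> \<nu> integral_density nonneg)
qed

text \<open>The two pieces of the split integral are compared separately: on \<open>q x > 0\<close>
  the minorant lies below \<open>ext0 f\<close>, and on \<open>q x = 0\<close> the slope lies below
  \<open>slope_inf f\<close>.\<close>

lemma minorant_fields_le_f_divergence_dens:
  assumes f: "convex_on {0<..} f" and mf: "minorant_fields f M \<alpha> \<beta>"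
  shows "ereal ((\<integral>x. \<alpha> x \<partial>\<mu>) + (\<integral>x. \<beta> x \<partial>\<nu>)) \<le> f_divergence_dens f \<mu> \<nu> p q"
proof -
  note [measurable] = p q
  have sp: "space \<mu> = space M" "space \<nu> = space M" by (simp_all add: \<mu> \<nu>)
  obtain K where [measurable]: "\<alpha> \<in> borel_measurable M" "\<beta> \<in> borel_measurable M"
    and K: "\<And>x. x \<in> space M \<Longrightarrow> \<bar>\<alpha> x\<bar> \<le> K" "\<And>x. x \<in> space M \<Longrightarrow> \<bar>\<beta> x\<bar> \<le> K"
    and am: "\<And>x. x \<in> space M \<Longrightarrow> (\<alpha> x, \<beta> x) \<in> affine_minorants f"
    using mf unfolding minorant_fields_def by blast
  note split = integral_split_densities[OF \<open>\<alpha> \<in> _\<close> \<open>\<beta> \<in> _\<close> K]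
  let ?Z = "{x \<in> space \<mu>. q x = 0}"
  have [measurable]: "?Z \<in> sets \<mu>" unfolding sp by (simp add: \<mu>)
  let ?l = "\<lambda>x. (\<alpha> x * (p x / q x) + \<beta> x) * indicator {x \<in> space \<nu>. q x > 0} x"
  have "ereal (?l x) \<le> ext0 f (p x / q x) * indicator {x \<in> space \<nu>. q x > 0} x"
    if "x \<in> space \<nu>" for x
  proof (cases "q x > 0")
    case True
    then show ?thesis
      using affine_minorant_le_ext0[OF f am, of x "p x / q x"] nonneg[of x] that by (simp add: sp)
  qed simp
  then have "ereal_integral \<nu> (\<lambda>x. ereal (?l x)) \<le>
      ereal_integral \<nu> (\<lambda>x. ext0 f (p x / q x) * indicator {x \<in> space \<nu>. q x > 0} x)"
    by (rule ereal_integral_mono)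
  then have 1: "ereal (\<integral>x. ?l x \<partial>\<nu>) \<le>
      ereal_integral \<nu> (\<lambda>x. ext0 f (p x / q x) * indicator {x \<in> space \<nu>. q x > 0} x)"
    using split(1) by (simp add: ereal_integral_ereal)
  have emZ: "emeasure \<mu> ?Z = ennreal (measure \<mu> ?Z)"
    by (rule finite_measure.emeasure_eq_measure[OF fin(1)])
  have 2: "ereal (\<integral>x. \<alpha> x * indicator ?Z x \<partial>\<mu>) \<le> enn2ereal (emeasure \<mu> ?Z) * slope_inf f"
  proof (cases "slope_inf f")
    case (real s)
    have "integrable \<mu> (indicator ?Z :: 'a \<Rightarrow> real)"
      using finite_measure.emeasure_finite[OF fin(1), of ?Z]
      by (intro integrable_real_indicator) (auto simp: less_top)
    then have "(\<integral>x. \<alpha> x * indicator ?Z x \<partial>\<mu>) \<le> (\<integral>x. s * indicator ?Z x \<partial>\<mu>)"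
      using affine_minorant_slope_le[OF f am] real split(2)
      by (intro integral_mono integrable_mult_right) (auto simp: sp split: split_indicator)
    also have "\<dots> = s * measure \<mu> ?Z" by simp
    finally show ?thesis by (simp add: real emZ enn2ereal_ennreal mult.commute)
  next
    case PInf
    \<comment> \<open>If the singular part has mass 0, the right side is 0 by the convention for
      \<open>0 * \<infinity>\<close>, and the integral vanishes as well. Otherwise the right side is
      \<infinity>.\<close>
    show ?thesis
    proof (cases "measure \<mu> ?Z = 0")
      case True
      then have "emeasure \<mu> ?Z = 0" by (simp add: emZ)
      then have "AE x in \<mu>. x \<notin> ?Z" by (intro AE_not_in) (auto simp: null_sets_def)
      then have "(\<integral>x. \<alpha> x * indicator ?Z x \<partial>\<mu>) = 0"
        by (intro integral_eq_zero_AE) (auto elim!: eventually_mono)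
      then show ?thesis using True by (simp add: emZ zero_ennreal.rep_eq)
    next
      case False
      then have "measure \<mu> ?Z > 0" by (simp add: zero_less_measure_iff)
      then show ?thesis using PInf by (simp add: emZ enn2ereal_ennreal)
    qed
  next
    case MInf
    then show ?thesis using slope_inf_tendsto(2)[OF f] by simp
  qed
  show ?thesis
    unfolding f_divergence_dens_def by (subst split(3)) (use add_mono[OF 1 2] in simp_all)
qed

text \<open>The divergence is the limit of the values of admissible pairs: at each point, stage
  \<open>n\<close> picks the best of the first \<open>n + 1\<close> rational minorants, and monotone
  convergence does the rest.\<close>

lemma f_divergence_dens_le:
  assumes f: "convex_on {0<..} f"
    and le: "\<And>\<alpha> \<beta>. minorant_fields f M \<alpha> \<beta> \<Longrightarrow> ereal ((\<integral>x. \<alpha> x \<partial>\<mu>) + (\<integral>x. \<beta> x \<partial>\<nu>)) \<le> C"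
  shows "f_divergence_dens f \<mu> \<nu> p q \<le> C"
proof -
  note [measurable] = p q
  have sp: "space \<mu> = space M" "space \<nu> = space M" by (simp_all add: \<mu> \<nu>)
  define S where "S = affine_minorants f \<inter> \<rat> \<times> \<rat>"
  obtain a1 b1 where "(a1, b1) \<in> affine_minorants f"
    using convex_tangent_minorant[OF f zero_less_one] by blast
  then have "S \<noteq> {}" using affine_minorant_rational[of a1 b1 f 1] unfolding S_def by fastforce
  moreover have "countable S" unfolding S_def by (intro countable_Int2 countable_SIGMA countable_rat)
  moreover define c where "c = from_nat_into S"
  ultimately have c: "range c = S" by (simp add: range_from_nat_into)
  \<comment> \<open>Where \<open>q x = 0\<close> the slope alone is maximized, as it has to approach
    \<open>slope_inf f\<close>. The other formula would score the intercept there, because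
    \<open>p x / 0 = 0\<close>.\<close>
  define v where "v x ab = (if q x = 0 then fst ab else fst ab * (p x / q x) + snd ab)" for x and ab :: "real \<times> real"
  have vm: "(\<lambda>x. v x ab) \<in> borel_measurable M" for ab unfolding v_def by measurable
  define r where "r n x = running_argmax c (v x) n" for n x
  define \<alpha> \<beta> where "\<alpha> n x = fst (r n x)" and "\<beta> n x = snd (r n x)" for n x
  have [measurable]: "\<alpha> n \<in> borel_measurable M" "\<beta> n \<in> borel_measurable M" for n
    using measurable_running_argmax[of v M "\<lambda>_. fst" c n, OF vm]
      measurable_running_argmax[of v M "\<lambda>_. snd" c n, OF vm]
    by (simp_all add: \<alpha>_def[abs_def] \<beta>_def[abs_def] r_def)
  have rin: "(\<alpha> n x, \<beta> n x) \<in> c ` {..n}" for n x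
    using running_argmax_in[of c "v x" n] by (simp add: \<alpha>_def \<beta>_def r_def)
  \<comment> \<open>Stage \<open>n\<close> uses only finitely many minorants, so the sum of all
    their coefficients in absolute value bounds both fields uniformly in \<open>x\<close>.\<close>
  define K where "K n = (\<Sum>k\<le>n. \<bar>fst (c k)\<bar> + \<bar>snd (c k)\<bar>)" for n
  have "\<bar>fst (c k)\<bar> + \<bar>snd (c k)\<bar> \<le> K n" if "k \<le> n" for k n
    unfolding K_def using that
    by (intro member_le_sum[where f = "\<lambda>k. \<bar>fst (c k)\<bar> + \<bar>snd (c k)\<bar>"]) auto
  then have "\<bar>\<alpha> n x\<bar> + \<bar>\<beta> n x\<bar> \<le> K n" for n x
    using rin[of n x] by (metis (no_types, lifting) atMost_iff fst_conv imageE snd_conv)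
  then have K: "\<bar>\<alpha> n x\<bar> \<le> K n" "\<bar>\<beta> n x\<bar> \<le> K n" for n x
    by (smt (verit, ccfv_threshold))+
  have am: "(\<alpha> n x, \<beta> n x) \<in> affine_minorants f" for n x
    using rin[of n x] c unfolding S_def by blast
  have mf: "minorant_fields f M (\<alpha> n) (\<beta> n)" for n
    unfolding minorant_fields_def using K[of n] am by (auto intro!: exI[of _ "K n"])
  have inc: "incseq (\<lambda>n. v x (\<alpha> n x, \<beta> n x))" for x
    using incseq_running_argmax[of "v x" c] by (simp add: \<alpha>_def \<beta>_def r_def)
  have SUP: "(SUP n. ereal (v x (\<alpha> n x, \<beta> n x))) = (SUP ab\<in>S. ereal (v x ab))" for x
    using SUP_running_argmax[of "v x" c] c by (simp add: \<alpha>_def \<beta>_def r_def)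
  note split = integral_split_densities[OF \<open>\<alpha> _ \<in> _\<close> \<open>\<beta> _ \<in> _\<close> K]
  let ?l = "\<lambda>n x. (\<alpha> n x * (p x / q x) + \<beta> n x) * indicator {x \<in> space \<nu>. q x > 0} x"
  let ?h = "\<lambda>x. ext0 f (p x / q x) * indicator {x \<in> space \<nu>. q x > 0} x"
  let ?Z = "{x \<in> space \<mu>. q x = 0}"
  have [measurable]: "?Z \<in> sets \<mu>" unfolding sp by (simp add: \<mu>)
  have 1: "(\<lambda>n. ereal (\<integral>x. ?l n x \<partial>\<nu>)) \<longlonglongrightarrow> ereal_integral \<nu> ?h"
  proof (rule ereal_integral_monotone_convergence)
    show "integrable \<nu> (?l n)" for n using split(1) .
    show "incseq (\<lambda>n. ?l n x)" for x
      using inc[of x] by (auto simp: v_def indicator_def incseq_def)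
    show "?h x = (SUP n. ereal (?l n x))" for x
    proof (cases "x \<in> space \<nu> \<and> q x > 0")
      case True
      then show ?thesis
        using SUP[of x] ext0_eq_SUP[OF f, of "p x / q x"] nonneg[of x]
        by (simp add: v_def S_def case_prod_beta)
    qed auto
  qed
  \<comment> \<open>On \<open>q x = 0\<close> the score does not depend on \<open>x\<close>, so the
    selected slope is a constant and its integral over the singular part is a plain product.\<close>
  define A where "A n = fst (running_argmax c fst n)" for n
  have \<alpha>A: "\<alpha> n x = A n" if "q x = 0" for n x
    using that by (simp add: \<alpha>_def r_def A_def v_def[abs_def])
  have "(\<lambda>n. ereal (A n)) \<longlonglongrightarrow> (SUP n. ereal (A n))"
    using incseq_running_argmax[of fst c] by (intro LIMSEQ_SUP) (auto simp: A_def incseq_def)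
  also have "(SUP n. ereal (A n)) = slope_inf f"
    unfolding A_def SUP_running_argmax c S_def slope_inf_eq_SUP[OF f, symmetric] by (simp add: case_prod_beta)
  finally have A: "(\<lambda>n. ereal (A n)) \<longlonglongrightarrow> slope_inf f" .
  have emZ: "emeasure \<mu> ?Z = ennreal (measure \<mu> ?Z)"
    by (rule finite_measure.emeasure_eq_measure[OF fin(1)])
  have "(\<integral>x. \<alpha> n x * indicator ?Z x \<partial>\<mu>) = (\<integral>x. A n * indicator ?Z x \<partial>\<mu>)" for n
    by (intro Bochner_Integration.integral_cong) (auto simp: indicator_def \<alpha>A)
  then have Zint: "ereal (\<integral>x. \<alpha> n x * indicator ?Z x \<partial>\<mu>) = enn2ereal (emeasure \<mu> ?Z) * ereal (A n)" for n
    by (simp add: emZ enn2ereal_ennreal mult.commute)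
  have 2: "(\<lambda>n. ereal (\<integral>x. \<alpha> n x * indicator ?Z x \<partial>\<mu>)) \<longlonglongrightarrow> enn2ereal (emeasure \<mu> ?Z) * slope_inf f"
    unfolding Zint by (rule tendsto_cmult_ereal[OF _ A]) (simp add: emZ enn2ereal_ennreal)
  \<comment> \<open>Neither limit may be -\<infinity>, so that the limits can be added. The singular
    term inherits this from \<open>slope_inf f\<close>; the other one is bounded below by the finite
    integral of stage 0.\<close>
  have slope: "enn2ereal (emeasure \<mu> ?Z) * slope_inf f \<noteq> -\<infinity>"
    using slope_inf_tendsto(2)[OF f] by (cases "slope_inf f") (auto simp: emZ enn2ereal_ennreal zero_less_measure_iff)
  have "ereal (\<integral>x. ?l 0 x \<partial>\<nu>) \<le> ereal_integral \<nu> ?h"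
    unfolding ereal_integral_ereal[OF split(1), symmetric]
  proof (rule ereal_integral_mono)
    fix x assume "x \<in> space \<nu>"
    then show "ereal (?l 0 x) \<le> ?h x"
      using affine_minorant_le_ext0[OF f am[of 0 x], of "p x / q x"] nonneg[of x]
      by (simp add: indicator_def)
  qed
  then have "ereal_integral \<nu> ?h \<noteq> -\<infinity>" by auto
  then have "(\<lambda>n. ereal (\<integral>x. ?l n x \<partial>\<nu>) + ereal (\<integral>x. \<alpha> n x * indicator ?Z x \<partial>\<mu>))
      \<longlonglongrightarrow> f_divergence_dens f \<mu> \<nu> p q"
    unfolding f_divergence_dens_def using slope by (intro tendsto_add_ereal_general 1 2) auto
  moreover have "ereal (\<integral>x. ?l n x \<partial>\<nu>) + ereal (\<integral>x. \<alpha> n x * indicator ?Z x \<partial>\<mu>) \<le> C" for n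
    using le[OF mf[of n]] unfolding split(3) by simp
  ultimately show ?thesis by (intro LIMSEQ_le_const2) auto
qed

end

section \<open>From fixed densities to the divergence itself\<close>

text \<open>Both measures are absolutely continuous with respect to their finite sum. Their
  Radon-Nikodym derivatives are finite almost everywhere and hence have nonnegative real
  versions.\<close>

lemma finite_measures_common_densities:
  fixes \<mu> \<nu> :: "'a measure"
  assumes fin: "finite_measure \<mu>" "finite_measure \<nu>" and sets: "sets \<nu> = sets \<mu>"
  obtains M and p q :: "'a \<Rightarrow> real" where "sets M = sets \<mu>"
    "p \<in> borel_measurable M" "q \<in> borel_measurable M" "\<And>x. p x \<ge> 0" "\<And>x. q x \<ge> 0"
    "\<mu> = density M (\<lambda>x. ennreal (p x))" "\<nu> = density M (\<lambda>x. ennreal (q x))"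
proof -
  define L where "L = add_measure \<mu> \<nu>"
  have eL: "emeasure L A = emeasure \<mu> A + emeasure \<nu> A" if "A \<in> sets \<mu>" for A
    unfolding L_def by (rule emeasure_add_measure[OF sets that])
  have sL: "sets L = sets \<mu>" "space L = space \<mu>" by (simp_all add: L_def)
  interpret L: finite_measure L
    using eL[of "space \<mu>"] fin[THEN finite_measure.emeasure_finite]
    by (intro finite_measureI) (auto simp: sL)
  have dens: "\<exists>D. D \<in> borel_measurable L \<and> (\<forall>x. 0 \<le> D x) \<and> N = density L (\<lambda>x. ennreal (D x))"
    if N: "finite_measure N" "sets N = sets \<mu>" and le: "\<And>A. A \<in> sets \<mu> \<Longrightarrow> emeasure N A \<le> emeasure L A"
    for N
  proof -
    have ac: "absolutely_continuous L N"
      unfolding absolutely_continuous_def null_sets_def using N sL by (auto dest: le)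
    obtain D where D: "D \<in> borel_measurable L" "AE x in L. RN_deriv L N x = ennreal (D x)" "\<And>x. 0 \<le> D x"
      using L.real_RN_deriv[OF N(1) ac] N sL by metis
    have "N = density L (RN_deriv L N)" using L.density_RN_deriv[OF ac] N sL by simp
    also have "\<dots> = density L (\<lambda>x. ennreal (D x))" using D by (intro density_cong) auto
    finally show ?thesis using D by blast
  qed
  obtain p where "p \<in> borel_measurable L" "\<And>x. 0 \<le> p x" "\<mu> = density L (\<lambda>x. ennreal (p x))"
    using dens[OF fin(1)] eL by auto
  moreover obtain q where "q \<in> borel_measurable L" "\<And>x. 0 \<le> q x" "\<nu> = density L (\<lambda>x. ennreal (q x))"
    using dens[OF fin(2) sets] eL by auto
  ultimately show thesis using that sL by blast
qed

text \<open>Admissibility depends on the sigma-algebra alone, so pairs pass freely between \<mu> and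
  the dominating measure.\<close>

lemma minorant_fields_cong_sets:
  assumes "sets M = sets N" shows "minorant_fields f M = minorant_fields f N"
  unfolding minorant_fields_def fun_eq_iff
  using measurable_cong_sets[OF assms refl, of "borel :: real measure"] sets_eq_imp_space_eq[OF assms]
  by simp

text \<open>Independence of the divergence from the choice of densities,
  \<open>f_divergence_eq_dens\<close>, removes them from the bound. With
  \<open>f_divergence_le\<close> this gives the variational formula in terms of \<mu> and \<nu>
  alone.\<close>

lemma minorant_fields_le_f_divergence:
  assumes fin: "finite_measure \<mu>" "finite_measure \<nu>" and sets: "sets \<nu> = sets \<mu>"
    and f: "convex_on {0<..} f" and mf: "minorant_fields f \<mu> \<alpha> \<beta>"
  shows "ereal ((\<integral>x. \<alpha> x \<partial>\<mu>) + (\<integral>x. \<beta> x \<partial>\<nu>)) \<le> f_divergence f \<mu> \<nu>"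
proof -
  obtain M p q where M: "sets M = sets \<mu>"
    and d: "p \<in> borel_measurable M" "q \<in> borel_measurable M" "\<And>x. p x \<ge> 0" "\<And>x. q x \<ge> 0"
    "\<mu> = density M (\<lambda>x. ennreal (p x))" "\<nu> = density M (\<lambda>x. ennreal (q x))"
    using finite_measures_common_densities[OF fin sets] by metis
  have "minorant_fields f M \<alpha> \<beta>" using mf minorant_fields_cong_sets[OF M] by metis
  then show ?thesis
    using minorant_fields_le_f_divergence_dens[OF d fin f] f_divergence_eq_dens[OF d fin] by metis
qed

lemma f_divergence_le:
  assumes fin: "finite_measure \<mu>" "finite_measure \<nu>" and sets: "sets \<nu> = sets \<mu>"
    and f: "convex_on {0<..} f"
    and le: "\<And>\<alpha> \<beta>. minorant_fields f \<mu> \<alpha> \<beta> \<Longrightarrow> ereal ((\<integral>x. \<alpha> x \<partial>\<mu>) + (\<integral>x. \<beta> x \<partial>\<nu>)) \<le> C"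
  shows "f_divergence f \<mu> \<nu> \<le> C"
proof -
  obtain M p q where M: "sets M = sets \<mu>"
    and d: "p \<in> borel_measurable M" "q \<in> borel_measurable M" "\<And>x. p x \<ge> 0" "\<And>x. q x \<ge> 0"
    "\<mu> = density M (\<lambda>x. ennreal (p x))" "\<nu> = density M (\<lambda>x. ennreal (q x))"
    using finite_measures_common_densities[OF fin sets] by metis
  have "f_divergence_dens f \<mu> \<nu> p q \<le> C"
    by (rule f_divergence_dens_le[OF d fin f])
       (use le minorant_fields_cong_sets[OF M] in metis)
  then show ?thesis using f_divergence_eq_dens[OF d fin] by metis
qed

section \<open>Data processing by pulling back minorant fields\<close>

theorem theoremF1:
  fixes X :: "'a measure" and Y :: "'b measure" and \<mu> \<nu> :: "'a measure"
    and f :: "real \<Rightarrow> real" and \<Gamma> :: "'a \<Rightarrow> 'b"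
  assumes "finite_measure \<mu>" and "sets \<mu> = sets X"
    and "finite_measure \<nu>" and "sets \<nu> = sets X"
    and "emeasure \<nu> (space X) > 0"
    and "convex_on {0<..} f"
    and "\<Gamma> \<in> measurable X Y"
  shows "f_divergence f \<mu> \<nu> \<ge> f_divergence f (distr \<mu> Y \<Gamma>) (distr \<nu> Y \<Gamma>)"
proof (rule f_divergence_le)
  have \<Gamma>: "\<Gamma> \<in> measurable \<mu> Y" "\<Gamma> \<in> measurable \<nu> Y"
    using assms(2,4,7) by (auto cong: measurable_cong_sets)
  show "finite_measure (distr \<mu> Y \<Gamma>)" "finite_measure (distr \<nu> Y \<Gamma>)"
    using assms(1,3) \<Gamma> by (auto intro: finite_measure.finite_measure_distr)
  fix \<alpha> \<beta> assume "minorant_fields f (distr \<mu> Y \<Gamma>) \<alpha> \<beta>"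
  then obtain K where ab: "\<alpha> \<in> borel_measurable Y" "\<beta> \<in> borel_measurable Y"
    and K: "\<And>y. y \<in> space Y \<Longrightarrow> \<bar>\<alpha> y\<bar> \<le> K \<and> \<bar>\<beta> y\<bar> \<le> K"
    and am: "\<And>y. y \<in> space Y \<Longrightarrow> (\<alpha> y, \<beta> y) \<in> affine_minorants f"
    unfolding minorant_fields_def by auto
  \<comment> \<open>The bound and the minorant condition are pointwise and \<Gamma> maps into
    \<open>space Y\<close>, so an admissible pair on the target stays admissible after
    composition.\<close>
  have "minorant_fields f \<mu> (\<lambda>x. \<alpha> (\<Gamma> x)) (\<lambda>x. \<beta> (\<Gamma> x))"
    unfolding minorant_fields_def
    using measurable_compose[OF \<Gamma>(1) ab(1)] measurable_compose[OF \<Gamma>(1) ab(2)]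
      measurable_space[OF \<Gamma>(1)] K am by blast
  then have "ereal ((\<integral>x. \<alpha> (\<Gamma> x) \<partial>\<mu>) + (\<integral>x. \<beta> (\<Gamma> x) \<partial>\<nu>)) \<le> f_divergence f \<mu> \<nu>"
    using assms by (intro minorant_fields_le_f_divergence) auto
  \<comment> \<open>By change of variables the pulled-back pair has the same value as the original
    one.\<close>
  then show "ereal ((\<integral>y. \<alpha> y \<partial>distr \<mu> Y \<Gamma>) + (\<integral>y. \<beta> y \<partial>distr \<nu> Y \<Gamma>)) \<le> f_divergence f \<mu> \<nu>"
    using \<Gamma> ab by (simp add: integral_distr)
qed (use assms in auto)

end
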